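(* (i) Let $E$ be an infinite dimensional locally convex space and let $T:E\to E$ be a continuous linear operator which is weakly supercyclic and satisfies $q\circ T\le q$ for some continuous norm $q$ on $E$. Then $\sigma_p(T)\cap\partial\mathbb{D}=\emptyset$ and $\sigma_p(T')\cap\partial\mathbb{D}=\emptyset$. In particular, neither $T$ nor $T'$ has nonzero fixed points. (ii) Let $X$ be an infinite dimensional Banach space and let $T:X\to X$ be a weakly supercyclic operator. Then both the point spectrum $\sigma_p(T)$ of $T$ and the point spectrum $\sigma_p(T^* )$ of $T^*$ are contained in the open ball $B(0,\|T\|)=\{z\in\mathbb{C}:|z|<\|T\|\}$.
   Context: All spaces are complex. $\partial\mathbb{D}=\{z\in\mathbb{C}:|z|=1\}$. $\sigma_p$ denotes the point spectrum (set of eigenvalues). $T'$ denotes the adjoint of $T$ on the topological dual $E'$; it is denoted $T^*$ on $X^*$ in the Banach space case. Operators are continuous and linear. $T$ is weakly supercyclic if there is a vector $f$ such that $\{\lambda T^n f:\lambda\in\mathbb{C},\ n=0,1,2,\dots\}$ is dense in the space for its weak topology. *)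

theory Defs
  imports "HOL-Analysis.Analysis"
begin

class scaleC =
  fixes scaleC :: "complex \<Rightarrow> 'a \<Rightarrow> 'a" (infixr \<open>*\<^sub>C\<close> 75)

class complex_vector = real_vector + scaleC +
  assumes scaleC_add_right: "c *\<^sub>C (x + y) = c *\<^sub>C x + c *\<^sub>C y"
    and scaleC_add_left: "(c + d) *\<^sub>C x = c *\<^sub>C x + d *\<^sub>C x"
    and scaleC_scaleC: "c *\<^sub>C d *\<^sub>C x = (c * d) *\<^sub>C x"
    and scaleC_one: "1 *\<^sub>C x = x"
    and scaleR_scaleC: "r *\<^sub>R x = complex_of_real r *\<^sub>C x"

global_interpretation complex_vector:
  vector_space "scaleC :: complex \<Rightarrow> 'a \<Rightarrow> 'a::complex_vector"
  by unfold_locales (simp_all add: scaleC_add_right scaleC_add_left scaleC_scaleC scaleC_one)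

text \<open>Hausdorffness is not part of the definition of a locally convex space; it is automatic
  as soon as there is a continuous norm. The last conjunct of the final axiom is \<open>convex V\<close>,
  which cannot be named in a class specification because its type is constrained to
  \<^class>\<open>real_vector\<close>.\<close>

class complex_lcs = complex_vector + topological_ab_group_add +
  assumes tendsto_scaleC_Pair:
      "LIM z (nhds c \<times>\<^sub>F nhds x). fst z *\<^sub>C snd z :> nhds (c *\<^sub>C x)"
    and locally_convex_raw:
      "open U \<Longrightarrow> 0 \<in> U \<Longrightarrow> \<exists>V. open V \<and> 0 \<in> V \<and> V \<subseteq> U \<and>
        (\<forall>x\<in>V. \<forall>y\<in>V. \<forall>u\<ge>0. \<forall>v\<ge>0. u + v = 1 \<longrightarrow> u *\<^sub>R x + v *\<^sub>R y \<in> V)"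

lemma locally_convex:
  fixes U :: "'a::complex_lcs set"
  assumes "open U" "0 \<in> U"
  shows "\<exists>V. open V \<and> convex V \<and> 0 \<in> V \<and> V \<subseteq> U"
  using locally_convex_raw[OF assms] unfolding convex_def by blast

class complex_normed_vector = complex_vector + real_normed_vector +
  assumes norm_scaleC: "norm (c *\<^sub>C x) = cmod c * norm x"

class complex_banach = complex_normed_vector + banach

instance complex_normed_vector \<subseteq> complex_lcs
proof
  fix c :: complex and x :: 'a
  interpret bounded_bilinear "scaleC :: complex \<Rightarrow> 'a \<Rightarrow> 'a"
    by (unfold_locales; (intro exI[of _ 1])?)
      (simp_all add: scaleC_add_right scaleC_add_left scaleR_scaleC scaleC_scaleC
        norm_scaleC mult.commute scaleR_conv_of_real)
  show "LIM z (nhds c \<times>\<^sub>F nhds x). fst z *\<^sub>C snd z :> nhds (c *\<^sub>C x)"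
    by (intro tendsto filterlim_fst filterlim_snd)
next
  fix U :: "'a set"
  assume "open U" "0 \<in> U"
  then obtain e where "e > 0" "ball 0 e \<subseteq> U"
    by (auto simp: open_contains_ball)
  then show "\<exists>V. open V \<and> 0 \<in> V \<and> V \<subseteq> U \<and>
      (\<forall>x\<in>V. \<forall>y\<in>V. \<forall>u\<ge>0. \<forall>v\<ge>0. u + v = 1 \<longrightarrow> u *\<^sub>R x + v *\<^sub>R y \<in> V)"
    unfolding convex_def[symmetric] by (intro exI[of _ "ball 0 e"]) auto
qed

instantiation complex :: complex_normed_vector
begin

definition scaleC_complex :: "complex \<Rightarrow> complex \<Rightarrow> complex"
  where "scaleC_complex c z = c * z"

instance
  by standard (simp_all add: scaleC_complex_def algebra_simps scaleR_conv_of_real norm_mult)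

end

definition infinite_dimensional :: "'a::complex_vector itself \<Rightarrow> bool"
  where "infinite_dimensional _ \<longleftrightarrow>
    (\<nexists>B::'a set. finite B \<and> complex_vector.span B = UNIV)"

definition continuous_clinear ::
  "('a::{complex_vector,topological_space} \<Rightarrow> 'b::{complex_vector,topological_space}) \<Rightarrow> bool"
  where "continuous_clinear T \<longleftrightarrow>
    Vector_Spaces.linear scaleC scaleC T \<and> continuous_on UNIV T"

definition continuous_norm :: "('a::{complex_vector,topological_space} \<Rightarrow> real) \<Rightarrow> bool"
  where "continuous_norm q \<longleftrightarrow>
    (\<forall>x y. q (x + y) \<le> q x + q y) \<and>
    (\<forall>c x. q (c *\<^sub>C x) = cmod c * q x) \<and>
    (\<forall>x. q x = 0 \<longrightarrow> x = 0) \<and>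
    continuous_on UNIV q"

typedef (overloaded) 'a dual =
  "{\<phi> :: 'a::{complex_vector,topological_space} \<Rightarrow> complex. continuous_clinear \<phi>}"
  morphisms dual_apply Abs_dual
proof
  show "(\<lambda>_. 0) \<in> {\<phi> :: 'a \<Rightarrow> complex. continuous_clinear \<phi>}"
    by (auto simp: continuous_clinear_def intro!: Vector_Spaces.linear.intro
        complex_vector.vector_space_axioms module_hom.intro module_hom_axioms.intro
        complex_vector.module_axioms)
qed

setup_lifting type_definition_dual

lemma continuous_clinear_iff:
  "continuous_clinear T \<longleftrightarrow>
    (\<forall>x y. T (x + y) = T x + T y) \<and> (\<forall>c x. T (c *\<^sub>C x) = c *\<^sub>C T x) \<and> continuous_on UNIV T"
  unfolding continuous_clinear_def Vector_Spaces.linear_iff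
  by (auto simp: complex_vector.vector_space_axioms)

instantiation dual :: ("{complex_vector,topological_space}") complex_vector
begin

lift_definition zero_dual :: "'a dual" is "\<lambda>_. 0"
  by (simp add: continuous_clinear_iff scaleC_complex_def)

lift_definition plus_dual :: "'a dual \<Rightarrow> 'a dual \<Rightarrow> 'a dual" is "\<lambda>\<phi> \<psi> x. \<phi> x + \<psi> x"
  by (auto simp: continuous_clinear_iff scaleC_complex_def algebra_simps intro: continuous_intros)

lift_definition uminus_dual :: "'a dual \<Rightarrow> 'a dual" is "\<lambda>\<phi> x. - \<phi> x"
  by (auto simp: continuous_clinear_iff scaleC_complex_def algebra_simps intro: continuous_intros)

lift_definition minus_dual :: "'a dual \<Rightarrow> 'a dual \<Rightarrow> 'a dual" is "\<lambda>\<phi> \<psi> x. \<phi> x - \<psi> x"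
  by (auto simp: continuous_clinear_iff scaleC_complex_def algebra_simps intro: continuous_intros)

lift_definition scaleC_dual :: "complex \<Rightarrow> 'a dual \<Rightarrow> 'a dual" is "\<lambda>c \<phi> x. c * \<phi> x"
  by (auto simp: continuous_clinear_iff scaleC_complex_def algebra_simps intro: continuous_intros)

lift_definition scaleR_dual :: "real \<Rightarrow> 'a dual \<Rightarrow> 'a dual" is "\<lambda>r \<phi> x. complex_of_real r * \<phi> x"
  by (auto simp: continuous_clinear_iff scaleC_complex_def algebra_simps intro: continuous_intros)

instance
  by standard (transfer; auto simp: algebra_simps)+

end

text \<open>If \<open>T\<close> is not continuous and linear, \<open>Abs_dual\<close> is applied outside its domain and the
  value is unspecified.\<close>

definition adjoint_op ::
  "('a::{complex_vector,topological_space} \<Rightarrow> 'a) \<Rightarrow> 'a dual \<Rightarrow> 'a dual"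
  where "adjoint_op T \<phi> = Abs_dual (dual_apply \<phi> \<circ> T)"

lemma dual_apply_adjoint_op:
  assumes "continuous_clinear T"
  shows "dual_apply (adjoint_op T \<phi>) x = dual_apply \<phi> (T x)"
proof -
  have "continuous_clinear (dual_apply \<phi> \<circ> T)"
    using assms dual_apply[of \<phi>] unfolding continuous_clinear_iff
    by (auto intro!: continuous_on_compose2[of UNIV "dual_apply \<phi>" UNIV T])
  then show ?thesis
    by (simp add: adjoint_op_def Abs_dual_inverse)
qed

definition point_spectrum :: "('a::complex_vector \<Rightarrow> 'a) \<Rightarrow> complex set"
  where "point_spectrum T = {\<mu>. \<exists>x. x \<noteq> 0 \<and> T x = \<mu> *\<^sub>C x}"

definition weak_topology :: "'a::{complex_vector,topological_space} topology"
  where "weak_topology = topology_generated_by {dual_apply \<phi> -` U |\<phi> U. open U}"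

definition weakly_supercyclic :: "('a::{complex_vector,topological_space} \<Rightarrow> 'a) \<Rightarrow> bool"
  where "weakly_supercyclic T \<longleftrightarrow>
    (\<exists>f. weak_topology closure_of {c *\<^sub>C (T ^^ n) f |c n. True} = UNIV)"

lemma topspace_weak_topology: "topspace weak_topology = UNIV"
proof -
  have "(UNIV :: 'a set) = dual_apply 0 -` UNIV"
    by simp
  then have "(UNIV :: 'a set) \<in> {dual_apply \<phi> -` U |\<phi> U. open U}"
    using open_UNIV by blast
  then show ?thesis
    unfolding weak_topology_def topology_generated_by_topspace by blast
qed

end

theory Submission
  imports Defs
begin

text \<open>Suppose \<open>q (T x) \<le> \<bar>\<mu>\<bar> q x\<close> for all \<open>x\<close>. If \<open>\<phi>\<close> is a nonzero eigenfunctional of \<open>T'\<close> for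
  \<open>\<mu>\<close> and \<open>f\<close> is a weakly supercyclic vector, then on the projective orbit of \<open>f\<close> the norm \<open>q\<close> is
  dominated by a multiple of \<open>\<bar>\<phi>\<bar>\<close>. By the Hahn--Banach theorem \<open>q\<close> is weakly lower semicontinuous,
  so the domination holds everywhere; hence \<open>\<phi>\<close> is injective and the space is at most
  one-dimensional. An eigenvector \<open>x\<close> of \<open>T\<close> for \<open>\<mu>\<close> reduces to this case: averaging over the
  iterates of \<open>T\<close> shows that \<open>x\<close> has \<open>q\<close>-distance \<open>q x > 0\<close> from the range of \<open>\<mu> - T\<close>, so
  Hahn--Banach yields a functional that vanishes on this range but not at \<open>x\<close>.\<close>

subsection \<open>The Hahn--Banach theorem\<close>

definition sublinear :: "('a::real_vector \<Rightarrow> real) \<Rightarrow> bool"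
  where "sublinear p \<longleftrightarrow>
    (\<forall>x y. p (x + y) \<le> p x + p y) \<and> (\<forall>r x. 0 \<le> r \<longrightarrow> p (r *\<^sub>R x) = r * p x)"

lemma sublinear_add: "sublinear p \<Longrightarrow> p (x + y) \<le> p x + p y"
  and sublinear_scaleR: "sublinear p \<Longrightarrow> 0 \<le> r \<Longrightarrow> p (r *\<^sub>R x) = r * p x"
  by (simp_all add: sublinear_def)

lemma sublinear_zero: "sublinear p \<Longrightarrow> p 0 = 0"
  using sublinear_scaleR[of p 0 0] by simp

lemma sublinear_minus_le: "sublinear p \<Longrightarrow> - p (- x) \<le> p x"
  using sublinear_add[of p x "- x"] sublinear_zero[of p] by simp

text \<open>Positive homogeneity needs only one inequality, since applying it to
  \<open>1 / r\<close> and \<open>r *\<^sub>R x\<close> gives the other. This is the inequality that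
  infima deliver directly.\<close>

lemma sublinearI:
  assumes "\<And>x y. p (x + y) \<le> p x + p y" "p 0 = 0"
    and le: "\<And>r x. 0 < r \<Longrightarrow> r * p x \<le> p (r *\<^sub>R x)"
  shows "sublinear p"
proof -
  have "p (r *\<^sub>R x) = r * p x" if "0 \<le> r" for r x
  proof (cases "r = 0")
    case False
    with that have "0 < r" by simp
    with le[of "1 / r" "r *\<^sub>R x"] have "p (r *\<^sub>R x) \<le> r * p x"
      by (simp add: field_simps)
    with le[OF \<open>0 < r\<close>, of x] show ?thesis by simp
  qed (simp add: assms)
  with assms show ?thesis by (simp add: sublinear_def)
qed

text \<open>\<open>lower p x\<close> is a sublinear minorant of \<open>p\<close> whose value at \<open>- x\<close> is at most \<open>- p x\<close>. A
  minimal sublinear functional coincides with all its minorants of this form; it is therefore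
  odd, and hence linear. This avoids extending functionals from subspaces.\<close>

definition lower :: "('a::real_vector \<Rightarrow> real) \<Rightarrow> 'a \<Rightarrow> 'a \<Rightarrow> real"
  where "lower p x y = (INF t\<in>{0..}. p (y + t *\<^sub>R x) - t * p x)"

lemma lower_le:
  assumes "sublinear p" "0 \<le> t"
  shows "lower p x y \<le> p (y + t *\<^sub>R x) - t * p x"
  unfolding lower_def
proof (rule cINF_lower)
  \<comment> \<open>The bound comes from splitting \<open>s *\<^sub>R x\<close> as
    \<open>(y + s *\<^sub>R x) + (- y)\<close>; it does not depend on \<open>s\<close>.\<close>
  have "- p (- y) \<le> p (y + s *\<^sub>R x) - s * p x" if "0 \<le> s" for s
    using sublinear_add[OF assms(1), of "y + s *\<^sub>R x" "- y"]
      sublinear_scaleR[OF assms(1) that, of x] by simp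
  then show "bdd_below ((\<lambda>t. p (y + t *\<^sub>R x) - t * p x) ` {0..})"
    by (intro bdd_belowI2) auto
qed (use assms in auto)

lemma le_lower:
  assumes "\<And>t. 0 \<le> t \<Longrightarrow> m \<le> p (y + t *\<^sub>R x) - t * p x"
  shows "m \<le> lower p x y"
  unfolding lower_def by (intro cINF_greatest) (use assms in auto)

lemma lower_le_self: "sublinear p \<Longrightarrow> lower p x y \<le> p y"
  using lower_le[of p 0 x y] by simp

lemma lower_minus: "sublinear p \<Longrightarrow> lower p x (- x) \<le> - p x"
  using lower_le[of p 1 x "- x"] by (simp add: sublinear_zero)

text \<open>Parameters \<open>s\<close> for \<open>y\<close> and \<open>t\<close> for
  \<open>z\<close> combine to \<open>s + t\<close> for \<open>y + z\<close>; the two infima are then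
  taken one after the other. Homogeneity is the substitution of \<open>t / r\<close> for
  \<open>t\<close>.\<close>

lemma sublinear_lower:
  assumes p: "sublinear p"
  shows "sublinear (lower p x)"
proof (rule sublinearI)
  fix y z
  have *: "lower p x (y + z) \<le> (p (y + s *\<^sub>R x) - s * p x) + (p (z + t *\<^sub>R x) - t * p x)"
    if "0 \<le> s" "0 \<le> t" for s t
    using lower_le[OF p, of "s + t" x "y + z"] that
      sublinear_add[OF p, of "y + s *\<^sub>R x" "z + t *\<^sub>R x"]
    by (simp add: algebra_simps)
  have "lower p x (y + z) - (p (y + s *\<^sub>R x) - s * p x) \<le> lower p x z" if "0 \<le> s" for s
    by (rule le_lower) (use *[OF that] in \<open>simp add: algebra_simps\<close>)
  then have "lower p x (y + z) - lower p x z \<le> lower p x y"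
    by (intro le_lower) (simp add: algebra_simps)
  then show "lower p x (y + z) \<le> lower p x y + lower p x z" by simp
next
  have "0 \<le> lower p x 0"
    by (rule le_lower) (simp add: sublinear_scaleR[OF p])
  then show "lower p x 0 = 0"
    using lower_le_self[OF p, of x 0] sublinear_zero[OF p] by simp
next
  fix r :: real and y
  assume r: "0 < r"
  show "r * lower p x y \<le> lower p x (r *\<^sub>R y)"
  proof (rule le_lower)
    fix t :: real
    assume t: "0 \<le> t"
    have "r *\<^sub>R y + t *\<^sub>R x = r *\<^sub>R (y + (t / r) *\<^sub>R x)"
      using r by (simp add: algebra_simps)
    then have "p (r *\<^sub>R y + t *\<^sub>R x) - t * p x = r * (p (y + (t / r) *\<^sub>R x) - (t / r) * p x)"
      using r sublinear_scaleR[OF p, of r "y + (t / r) *\<^sub>R x"] by (simp add: algebra_simps)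
    moreover have "r * lower p x y \<le> r * (p (y + (t / r) *\<^sub>R x) - (t / r) * p x)"
      using lower_le[OF p, of "t / r" x y] r t by (intro mult_left_mono) auto
    ultimately show "r * lower p x y \<le> p (r *\<^sub>R y + t *\<^sub>R x) - t * p x" by simp
  qed
qed

text \<open>Comparability is what makes the infimum subadditive: for \<open>p x + p' y\<close> the
  smaller of the two functionals serves both arguments. The common majorant \<open>p0\<close> bounds
  the values at \<open>x\<close> below by \<open>- p0 (- x)\<close>, so the infima are
  genuine.\<close>

lemma sublinear_INF_chain:
  assumes ne: "C \<noteq> {}" and sub: "\<And>p. p \<in> C \<Longrightarrow> sublinear p"
    and le: "\<And>p. p \<in> C \<Longrightarrow> p \<le> p0"
    and chain: "\<And>p p'. p \<in> C \<Longrightarrow> p' \<in> C \<Longrightarrow> p \<le> p' \<or> p' \<le> p"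
  shows "sublinear (\<lambda>x. INF p\<in>C. p x)" "p \<in> C \<Longrightarrow> (INF p\<in>C. p x) \<le> p x"
proof -
  have "- p0 (- x) \<le> p x" if "p \<in> C" for p x
    using sublinear_minus_le[OF sub[OF that], of x] le_funD[OF le[OF that], of "- x"] by linarith
  then have "bdd_below ((\<lambda>p. p x) ` C)" for x
    by (intro bdd_belowI2[where m = "- p0 (- x)"])
  then have lower: "(INF p\<in>C. p x) \<le> p x" if "p \<in> C" for p x
    by (rule cINF_lower) (fact that)
  then show "p \<in> C \<Longrightarrow> (INF p\<in>C. p x) \<le> p x" .
  show "sublinear (\<lambda>x. INF p\<in>C. p x)"
  proof (rule sublinearI)
    fix x y
    let ?I = "\<lambda>x. INF p\<in>C. p x"
    have *: "?I (x + y) \<le> p x + p' y" if "p \<in> C" "p' \<in> C" for p p'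
      using chain[OF that]
    proof
      assume "p \<le> p'"
      then show ?thesis
        using lower[OF that(1), of "x + y"] sublinear_add[OF sub[OF that(1)], of x y]
        by (auto dest!: le_funD[of _ _ y])
    next
      assume "p' \<le> p"
      then show ?thesis
        using lower[OF that(2), of "x + y"] sublinear_add[OF sub[OF that(2)], of x y]
        by (auto dest!: le_funD[of _ _ x])
    qed
    have "?I (x + y) - p x \<le> ?I y" if "p \<in> C" for p
      using *[OF that] by (intro cINF_greatest[OF ne]) (simp add: algebra_simps)
    then have "?I (x + y) - ?I y \<le> ?I x"
      by (intro cINF_greatest[OF ne]) (simp add: algebra_simps)
    then show "?I (x + y) \<le> ?I x + ?I y" by simp
  next
    show "(INF p\<in>C. p 0) = 0"
      using ne sub by (simp add: sublinear_zero)
  next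
    fix r :: real and x
    assume "0 < r"
    then have "r * (INF p\<in>C. p x) \<le> p (r *\<^sub>R x)" if "p \<in> C" for p
      using lower[OF that, of x] by (simp add: sublinear_scaleR[OF sub[OF that]])
    then show "r * (INF p\<in>C. p x) \<le> (INF p\<in>C. p (r *\<^sub>R x))"
      by (rule cINF_greatest[OF ne])
  qed
qed

lemma ex_minimal_sublinear:
  assumes p: "sublinear p"
  shows "\<exists>m. sublinear m \<and> m \<le> p \<and> (\<forall>m'. sublinear m' \<longrightarrow> m' \<le> m \<longrightarrow> m' = m)"
proof -
  let ?A = "{m. sublinear m \<and> m \<le> p}"
  have "\<exists>m\<in>?A. \<forall>m'\<in>?A. m' \<le> m \<longrightarrow> m' = m"
  proof (rule predicate_Zorn)
    \<comment> \<open>The order is reversed, so that a maximal element in the sense of Zorn's lemma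
      is a minimal functional. The empty chain is bounded by \<open>p\<close> itself.\<close>
    show "partial_order_on ?A (relation_of (\<ge>) ?A)"
      by (rule partial_order_on_relation_ofI) auto
  next
    fix C
    assume "C \<in> Chains (relation_of (\<ge>) ?A)"
    then have C: "C \<subseteq> ?A" and chain: "\<And>m m'. m \<in> C \<Longrightarrow> m' \<in> C \<Longrightarrow> m \<le> m' \<or> m' \<le> m"
      unfolding Chains_def relation_of_def by blast+
    show "\<exists>u\<in>?A. \<forall>m\<in>C. u \<le> m"
    proof (cases "C = {}")
      case False
      note I = sublinear_INF_chain[OF False _ _ chain, where ?p0.0 = p]
      have "\<forall>m\<in>C. (\<lambda>x. INF p\<in>C. p x) \<le> m"
      proof (intro ballI le_funI)
        show "(INF p\<in>C. p x) \<le> m x" if "m \<in> C" for m x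
          by (rule I(2)) (use C that in auto)
      qed
      moreover have "sublinear (\<lambda>x. INF p\<in>C. p x)"
        using C by (intro I(1)) auto
      ultimately show ?thesis
        using False C by (intro bexI[of _ "\<lambda>x. INF p\<in>C. p x"]) (auto, blast intro: order_trans)
    qed (use p in auto)
  qed
  then show ?thesis by (auto intro: order_trans)
qed

lemma linear_minimal_sublinear:
  assumes m: "sublinear m" and min: "\<And>m'. sublinear m' \<Longrightarrow> m' \<le> m \<Longrightarrow> m' = m"
  shows "linear m"
proof -
  have "lower m x = m" for x
    using sublinear_lower[OF m] lower_le_self[OF m] by (intro min le_funI)
  then have minus: "m (- x) = - m x" for x
    using lower_minus[OF m, of x] sublinear_minus_le[OF m, of x] by simp
  show ?thesis
  proof (rule linearI)
    fix x y r
    show "m (x + y) = m x + m y"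
      using sublinear_add[OF m, of x y] sublinear_add[OF m, of "- x" "- y"]
        minus[of x] minus[of y] minus[of "x + y"] by simp
    show "m (r *\<^sub>R x) = r *\<^sub>R m x"
      using sublinear_scaleR[OF m, of r x] sublinear_scaleR[OF m, of "- r" x]
        minus[of "r *\<^sub>R x"] by (cases "0 \<le> r") auto
  qed
qed

text \<open>The minimal functional is chosen below \<open>lower p x\<close> instead of
  \<open>p\<close>. This forces \<open>h (- x) \<le> - p x\<close>, hence equality at
  \<open>x\<close> once \<open>h\<close> is known to be linear.\<close>

theorem Hahn_Banach_sublinear:
  assumes p: "sublinear p"
  obtains h where "linear h" "\<And>y. h y \<le> p y" "h x = p x"
proof -
  from ex_minimal_sublinear[OF sublinear_lower[OF p, of x]] obtain h
    where h: "sublinear h" "h \<le> lower p x" and "\<And>m'. sublinear m' \<Longrightarrow> m' \<le> h \<Longrightarrow> m' = h"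
    by blast
  then have "linear h" by (intro linear_minimal_sublinear)
  moreover have le: "h y \<le> p y" for y
    using le_funD[OF h(2), of y] lower_le_self[OF p, of x y] by simp
  moreover have "p x \<le> h x"
    using le_funD[OF h(2), of "- x"] lower_minus[OF p, of x] linear_neg[OF \<open>linear h\<close>, of x] by simp
  ultimately show thesis using that[of h] le[of x] by simp
qed

section \<open>Complex seminorms and dominated continuous functionals\<close>

definition cseminorm :: "('a::complex_vector \<Rightarrow> real) \<Rightarrow> bool"
  where "cseminorm p \<longleftrightarrow>
    (\<forall>x y. p (x + y) \<le> p x + p y) \<and> (\<forall>c x. p (c *\<^sub>C x) = cmod c * p x)"

lemma cseminorm_add: "cseminorm p \<Longrightarrow> p (x + y) \<le> p x + p y"
  and cseminorm_scaleC: "cseminorm p \<Longrightarrow> p (c *\<^sub>C x) = cmod c * p x"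
  by (simp_all add: cseminorm_def)

lemma cseminorm_minus: "cseminorm p \<Longrightarrow> p (- x) = p x"
  using cseminorm_scaleC[of p "- 1" x] by (simp add: complex_vector.scale_minus_left scaleC_one)

lemma cseminorm_diff: "cseminorm p \<Longrightarrow> p (x - y) \<le> p x + p y"
  using cseminorm_add[of p x "- y"] cseminorm_minus[of p y] by simp

lemma cseminorm_zero: "cseminorm p \<Longrightarrow> p 0 = 0"
  using cseminorm_scaleC[of p 0 0] by simp

lemma cseminorm_nonneg: "cseminorm p \<Longrightarrow> 0 \<le> p x"
  using cseminorm_diff[of p x x] cseminorm_zero[of p] by simp

theorem Hahn_Banach_cseminorm:
  fixes p :: "'a::complex_vector \<Rightarrow> real"
  assumes p: "cseminorm p"
  obtains \<psi> :: "'a \<Rightarrow> complex"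
  where "\<And>y z. \<psi> (y + z) = \<psi> y + \<psi> z" "\<And>c y. \<psi> (c *\<^sub>C y) = c * \<psi> y"
    "\<And>y. cmod (\<psi> y) \<le> p y" "\<psi> x = complex_of_real (p x)"
proof -
  have "sublinear p"
    using p by (auto simp: sublinear_def cseminorm_def scaleR_scaleC)
  then obtain h where h: "linear h" "\<And>y. h y \<le> p y" "h x = p x"
    by (rule Hahn_Banach_sublinear[of p x]) blast
  \<comment> \<open>Used at \<open>c\<close> and at \<open>\<i> * c\<close>, this gives the real and
    imaginary parts of complex homogeneity of \<open>\<psi>\<close>, the functional with real part
    \<open>h\<close>.\<close>
  have h_scale: "h (c *\<^sub>C y) = Re c * h y + Im c * h (\<i> *\<^sub>C y)" for c y
  proof -
    have "c *\<^sub>C y = Re c *\<^sub>R y + Im c *\<^sub>R (\<i> *\<^sub>C y)"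
      by (simp add: scaleR_scaleC scaleC_scaleC flip: scaleC_add_left)
        (metis complex_eq mult.commute)
    then show ?thesis
      using h(1) by (simp add: linear_add linear_scale)
  qed
  define \<psi> where "\<psi> y = Complex (h y) (- h (\<i> *\<^sub>C y))" for y
  have scale: "\<psi> (c *\<^sub>C y) = c * \<psi> y" for c y
    using h_scale[of c y] h_scale[of "\<i> * c" y]
    by (simp add: \<psi>_def complex_eq_iff scaleC_scaleC algebra_simps)
  have bound: "cmod (\<psi> y) \<le> p y" for y
  proof (cases "\<psi> y = 0")
    case False
    \<comment> \<open>Rotation by this unimodular factor makes the value of \<open>\<psi>\<close>
      real and nonnegative, so that it equals the value of \<open>h\<close>.\<close>
    define c where "c = complex_of_real (cmod (\<psi> y)) / \<psi> y"
    with False have "\<psi> (c *\<^sub>C y) = complex_of_real (cmod (\<psi> y))" "cmod c = 1"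
      by (simp_all add: scale norm_divide)
    then have "cmod (\<psi> y) = h (c *\<^sub>C y)"
      by (simp add: \<psi>_def complex_eq_iff)
    also have "\<dots> \<le> p y"
      using h(2)[of "c *\<^sub>C y"] cseminorm_scaleC[OF p, of c y] \<open>cmod c = 1\<close> by simp
    finally show ?thesis .
  qed (simp add: cseminorm_nonneg[OF p])
  \<comment> \<open>The real part of \<open>\<psi> x\<close> is already \<open>p x\<close>, so a
    modulus of at most \<open>p x\<close> leaves no room for an imaginary part.\<close>
  have "(cmod (\<psi> x))\<^sup>2 \<le> (p x)\<^sup>2"
    using bound[of x] by (simp add: power_mono)
  then have "\<psi> x = complex_of_real (p x)"
    by (simp add: \<psi>_def cmod_power2 h(3) complex_eq_iff)
  moreover have "\<psi> (y + z) = \<psi> y + \<psi> z" for y z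
    using h(1) by (simp add: \<psi>_def complex_eq_iff scaleC_add_right linear_add)
  ultimately show thesis using that scale bound by blast
qed

text \<open>Two functions separate two roles: \<open>p\<close> bounds the functional, while the
  larger \<open>q\<close> supplies its continuity through \<open>q (y - a)\<close> tending to 0.
  Later \<open>p\<close> is either \<open>q\<close> itself or a quotient seminorm of
  \<open>q\<close>.\<close>

lemma ex_dual_dominated:
  fixes p q :: "'a::complex_lcs \<Rightarrow> real"
  assumes p: "cseminorm p" and le: "\<And>y. p y \<le> q y" and cont: "continuous_on UNIV q"
    and q: "q 0 = 0"
  obtains \<psi> where "\<And>y. cmod (dual_apply \<psi> y) \<le> p y" "dual_apply \<psi> x = complex_of_real (p x)"
proof -
  obtain \<psi> :: "'a \<Rightarrow> complex" where \<psi>: "\<And>y z. \<psi> (y + z) = \<psi> y + \<psi> z"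
    "\<And>c y. \<psi> (c *\<^sub>C y) = c * \<psi> y" "\<And>y. cmod (\<psi> y) \<le> p y" "\<psi> x = complex_of_real (p x)"
    by (rule Hahn_Banach_cseminorm[OF p, of x]) (rule that)
  have diff: "\<psi> (y - z) = \<psi> y - \<psi> z" for y z
    using \<psi>(1)[of "y - z" z] by simp
  have "(\<psi> \<longlongrightarrow> \<psi> a) (at a)" for a
  proof -
    have "((\<lambda>y. y - a) \<longlongrightarrow> a - a) (at a)"
      by (intro tendsto_diff tendsto_ident_at tendsto_const)
    from continuous_on_tendsto_compose[OF cont this]
    have lim: "((\<lambda>y. q (y - a)) \<longlongrightarrow> 0) (at a)"
      by (simp add: q)
    have "cmod (\<psi> y - \<psi> a) \<le> q (y - a)" for y
      using order_trans[OF \<psi>(3) le, of "y - a"] by (simp only: diff)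
    then have "\<forall>y. cmod (\<psi> y - \<psi> a) \<le> q (y - a)" by blast
    from Lim_null_comparison[OF always_eventually[OF this] lim]
    have "((\<lambda>y. \<psi> y - \<psi> a) \<longlongrightarrow> 0) (at a)" .
    then show ?thesis by (rule LIM_zero_cancel)
  qed
  then have "continuous_clinear \<psi>"
    using \<psi>(1,2) by (auto simp: continuous_clinear_iff scaleC_complex_def continuous_on_def)
  then have "dual_apply (Abs_dual \<psi>) = \<psi>"
    by (simp add: Abs_dual_inverse)
  then show thesis
    by (intro that[of "Abs_dual \<psi>"]) (simp_all only: \<psi>)
qed

subsection \<open>Dual eigenvectors of weakly supercyclic operators\<close>

lemma dual_apply_scaleC: "dual_apply \<phi> (c *\<^sub>C x) = c * dual_apply \<phi> x"
  using dual_apply[of \<phi>] by (simp add: continuous_clinear_iff scaleC_complex_def)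

lemma dual_apply_diff: "dual_apply \<phi> (x - y) = dual_apply \<phi> x - dual_apply \<phi> y"
proof -
  have "dual_apply \<phi> (x - y + y) = dual_apply \<phi> (x - y) + dual_apply \<phi> y"
    using dual_apply[of \<phi>] unfolding continuous_clinear_iff by blast
  then show ?thesis by simp
qed

lemma openin_weak_topology_vimage: "open U \<Longrightarrow> openin weak_topology (dual_apply \<phi> -` U)"
  unfolding weak_topology_def by (rule topology_generated_by_Basis) blast

text \<open>Weak density is used through two functionals at a time: the eigenfunctional and a
  functional norming the point to be approximated.\<close>

lemma weakly_supercyclic_approx:
  assumes "weakly_supercyclic T"
  obtains f where "\<And>x \<phi> \<psi> e. 0 < e \<Longrightarrow> \<exists>c n.
    cmod (dual_apply \<phi> (c *\<^sub>C (T ^^ n) f) - dual_apply \<phi> x) < e \<and>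
    cmod (dual_apply \<psi> (c *\<^sub>C (T ^^ n) f) - dual_apply \<psi> x) < e"
proof -
  from assms obtain f where f: "weak_topology closure_of {c *\<^sub>C (T ^^ n) f |c n. True} = UNIV"
    unfolding weakly_supercyclic_def by iprover
  have "\<exists>c n. cmod (dual_apply \<phi> (c *\<^sub>C (T ^^ n) f) - dual_apply \<phi> x) < e \<and>
    cmod (dual_apply \<psi> (c *\<^sub>C (T ^^ n) f) - dual_apply \<psi> x) < e" if "0 < e" for x \<phi> \<psi> e
  proof -
    let ?W = "dual_apply \<phi> -` ball (dual_apply \<phi> x) e \<inter> dual_apply \<psi> -` ball (dual_apply \<psi> x) e"
    have "openin weak_topology ?W"
      by (intro openin_Int openin_weak_topology_vimage open_ball)
    moreover have "x \<in> ?W"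
      using that by simp
    moreover have "x \<in> weak_topology closure_of {c *\<^sub>C (T ^^ n) f |c n. True}"
      unfolding f by (rule UNIV_I)
    ultimately have "\<exists>y. y \<in> {c *\<^sub>C (T ^^ n) f |c n. True} \<and> y \<in> ?W"
      unfolding in_closure_of by iprover
    then obtain c n where "c *\<^sub>C (T ^^ n) f \<in> ?W" by auto
    then show ?thesis
      by (intro exI[of _ c] exI[of _ n]) (simp add: dist_norm norm_minus_commute)
  qed
  then show thesis by (rule that)
qed

lemma seminorm_funpow_le:
  assumes "\<And>x. q (T x) \<le> m * q x" "0 \<le> (m::real)"
  shows "q ((T ^^ n) x) \<le> m ^ n * q x"
proof (induction n)
  case (Suc n)
  have "q ((T ^^ Suc n) x) \<le> m * q ((T ^^ n) x)"
    using assms by simp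
  also have "\<dots> \<le> m * (m ^ n * q x)"
    using Suc assms(2) by (rule mult_left_mono)
  finally show ?case by (simp add: ac_simps)
qed simp

lemma weakly_supercyclic_no_dual_eigenvector:
  fixes T :: "'a::complex_lcs \<Rightarrow> 'a"
  assumes inf: "infinite_dimensional TYPE('a)" and T: "weakly_supercyclic T"
    and q: "cseminorm q" and q0: "\<And>x. q x = 0 \<Longrightarrow> x = 0" and cont: "continuous_on UNIV q"
    and le: "\<And>x. q (T x) \<le> cmod \<mu> * q x"
    and eig: "\<And>x. dual_apply \<phi> (T x) = \<mu> * dual_apply \<phi> x"
  shows "\<phi> = 0"
proof (rule ccontr)
  assume "\<phi> \<noteq> 0"
  then obtain x0 where x0: "dual_apply \<phi> x0 \<noteq> 0"
    by (metis (no_types) dual_apply_inject ext zero_dual.rep_eq)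
  obtain f where approx: "\<And>x \<phi> \<psi> e. 0 < e \<Longrightarrow> \<exists>c n.
      cmod (dual_apply \<phi> (c *\<^sub>C (T ^^ n) f) - dual_apply \<phi> x) < e \<and>
      cmod (dual_apply \<psi> (c *\<^sub>C (T ^^ n) f) - dual_apply \<psi> x) < e"
    using weakly_supercyclic_approx[OF T] by blast
  have pow: "dual_apply \<phi> ((T ^^ n) f) = \<mu> ^ n * dual_apply \<phi> f" for n
    by (induction n) (simp_all add: eig)
  \<comment> \<open>Otherwise \<open>\<phi>\<close> vanishes on the whole projective orbit, whose
    values could not come closer to \<open>dual_apply \<phi> x0\<close> than its modulus.\<close>
  have f: "dual_apply \<phi> f \<noteq> 0"
  proof
    assume "dual_apply \<phi> f = 0"
    with approx[of "cmod (dual_apply \<phi> x0)" \<phi> x0 \<phi>] x0 show False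
      by (simp add: dual_apply_scaleC pow)
  qed
  have dom: "q x * cmod (dual_apply \<phi> f) \<le> q f * cmod (dual_apply \<phi> x)" for x
  proof (rule field_le_epsilon)
    fix e :: real
    assume "0 < e"
    \<comment> \<open>This functional norms \<open>x\<close>; it carries the weak lower
      semicontinuity of \<open>q\<close> at \<open>x\<close>.\<close>
    obtain \<psi> where \<psi>: "\<And>y. cmod (dual_apply \<psi> y) \<le> q y" "dual_apply \<psi> x = complex_of_real (q x)"
      using ex_dual_dominated[OF q order_refl cont cseminorm_zero[OF q]] by blast
    \<comment> \<open>The two approximation errors \<open>e / s\<close> get multiplied by
      \<open>q f\<close> and by \<open>cmod (dual_apply \<phi> f)\<close>; with this
      \<open>s\<close> they add up to exactly \<open>e\<close>.\<close>
    define s where "s = q f + cmod (dual_apply \<phi> f)"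
    have s: "0 < s"
      using f cseminorm_nonneg[OF q, of f] by (simp add: s_def add_nonneg_pos)
    with \<open>0 < e\<close> obtain c n
      where \<phi>': "cmod (dual_apply \<phi> (c *\<^sub>C (T ^^ n) f) - dual_apply \<phi> x) < e / s"
        and \<psi>': "cmod (dual_apply \<psi> (c *\<^sub>C (T ^^ n) f) - dual_apply \<psi> x) < e / s"
      using approx[of "e / s" \<phi> x \<psi>] by auto
    \<comment> \<open>At the orbit point, \<open>\<bar>\<phi>\<bar>\<close> is exactly
      \<open>b\<close> times its value at \<open>f\<close>, and \<open>q\<close> is at most
      \<open>b\<close> times its value at \<open>f\<close>. Thus \<open>b\<close> can be
      eliminated.\<close>
    define b where "b = cmod c * cmod \<mu> ^ n"
    have "q x = cmod (dual_apply \<psi> x)"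
      using \<psi>(2) cseminorm_nonneg[OF q, of x] by simp
    also have "\<dots> \<le> cmod (dual_apply \<psi> (c *\<^sub>C (T ^^ n) f)) + e / s"
      using \<psi>' norm_triangle_ineq3[of "dual_apply \<psi> (c *\<^sub>C (T ^^ n) f)" "dual_apply \<psi> x"] by linarith
    also have "cmod (dual_apply \<psi> (c *\<^sub>C (T ^^ n) f)) \<le> cmod c * q ((T ^^ n) f)"
      using \<psi>(1)[of "c *\<^sub>C (T ^^ n) f"] by (simp add: cseminorm_scaleC[OF q])
    also have "\<dots> \<le> b * q f"
      using seminorm_funpow_le[of q T "cmod \<mu>" n f, OF le]
      by (simp add: b_def mult_left_mono mult.assoc)
    finally have "q x * cmod (dual_apply \<phi> f) \<le> (b * q f + e / s) * cmod (dual_apply \<phi> f)"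
      by (simp add: mult_right_mono)
    also have "\<dots> = (b * cmod (dual_apply \<phi> f)) * q f + e / s * cmod (dual_apply \<phi> f)"
      by (simp add: algebra_simps)
    also have "b * cmod (dual_apply \<phi> f) = cmod (dual_apply \<phi> (c *\<^sub>C (T ^^ n) f))"
      by (simp add: b_def dual_apply_scaleC pow norm_mult norm_power)
    also have "\<dots> * q f \<le> (cmod (dual_apply \<phi> x) + e / s) * q f"
      using \<phi>' norm_triangle_ineq3[of "dual_apply \<phi> (c *\<^sub>C (T ^^ n) f)" "dual_apply \<phi> x"]
      by (intro mult_right_mono cseminorm_nonneg[OF q]) linarith
    also have "(cmod (dual_apply \<phi> x) + e / s) * q f + e / s * cmod (dual_apply \<phi> f)
        = q f * cmod (dual_apply \<phi> x) + e / s * s"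
      unfolding s_def by (simp only: algebra_simps)
    finally show "q x * cmod (dual_apply \<phi> f) \<le> q f * cmod (dual_apply \<phi> x) + e"
      using s by simp
  qed
  have ker: "x = 0" if "dual_apply \<phi> x = 0" for x
    using dom[of x] that f cseminorm_nonneg[OF q, of x] q0[of x]
    by (simp add: mult_le_0_iff)
  have "x \<in> complex_vector.span {f}" for x
  proof -
    have "x - (dual_apply \<phi> x / dual_apply \<phi> f) *\<^sub>C f = 0"
      using f by (intro ker) (simp add: dual_apply_diff dual_apply_scaleC)
    then show ?thesis
      by (simp add: complex_vector.span_singleton)
  qed
  then show False
    using inf unfolding infinite_dimensional_def by blast
qed

subsection \<open>From eigenvectors to dual eigenvectors\<close>

text \<open>This is the quotient seminorm modulo \<open>M\<close>, that is, the
  \<open>q\<close>-distance to \<open>M\<close>. Subspace closure lets approximants be added and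
  rescaled; applying the scaling inequality to \<open>inverse c\<close> as well turns it into an
  equality.\<close>

lemma cseminorm_quotient:
  fixes q :: "'a::complex_vector \<Rightarrow> real"
  assumes q: "cseminorm q" and M: "complex_vector.subspace M"
  shows "cseminorm (\<lambda>y. INF m\<in>M. q (y - m))" (is "cseminorm ?p")
    and "m \<in> M \<Longrightarrow> (INF m\<in>M. q (y - m)) \<le> q (y - m)"
proof -
  have ne: "M \<noteq> {}" using complex_vector.subspace_0[OF M] by blast
  have lower: "?p y \<le> q (y - m)" if "m \<in> M" for y m
    using that by (intro cINF_lower bdd_belowI2[where m = 0] cseminorm_nonneg[OF q])
  then show "m \<in> M \<Longrightarrow> ?p y \<le> q (y - m)" .
  have add: "?p (y + z) \<le> ?p y + ?p z" for y z
  proof -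
    have *: "?p (y + z) \<le> q (y - m) + q (z - m')" if "m \<in> M" "m' \<in> M" for m m'
      using lower[OF complex_vector.subspace_add[OF M that], of "y + z"]
        cseminorm_add[OF q, of "y - m" "z - m'"] by (simp add: algebra_simps)
    have "?p (y + z) - q (y - m) \<le> ?p z" if "m \<in> M" for m
      using *[OF that] by (intro cINF_greatest[OF ne]) (simp add: algebra_simps)
    then have "?p (y + z) - ?p z \<le> ?p y"
      by (intro cINF_greatest[OF ne]) (simp add: algebra_simps)
    then show ?thesis by simp
  qed
  have ge: "cmod c * ?p y \<le> ?p (c *\<^sub>C y)" if "c \<noteq> 0" for c y
  proof (rule cINF_greatest[OF ne])
    fix m
    assume "m \<in> M"
    then have "?p y \<le> q (y - inverse c *\<^sub>C m)"
      by (intro lower complex_vector.subspace_scale[OF M])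
    then have "cmod c * ?p y \<le> q (c *\<^sub>C (y - inverse c *\<^sub>C m))"
      unfolding cseminorm_scaleC[OF q] by (rule mult_left_mono) simp
    then show "cmod c * ?p y \<le> q (c *\<^sub>C y - m)"
      using that by (simp add: complex_vector.scale_right_diff_distrib scaleC_scaleC scaleC_one)
  qed
  have zero: "?p 0 = 0"
    using lower[OF complex_vector.subspace_0[OF M], of 0] cseminorm_zero[OF q]
    by (intro antisym cINF_greatest[OF ne] cseminorm_nonneg[OF q]) simp
  have "?p (c *\<^sub>C y) = cmod c * ?p y" for c y
  proof (cases "c = 0")
    case False
    have "cmod (inverse c) * ?p (c *\<^sub>C y) \<le> ?p y"
      using ge[of "inverse c" "c *\<^sub>C y"] False by (simp add: scaleC_scaleC scaleC_one)
    then have "?p (c *\<^sub>C y) \<le> cmod c * ?p y"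
      using False by (simp add: norm_inverse norm_divide field_simps)
    with ge[OF False, of y] show ?thesis by simp
  qed (use zero in simp)
  with add show "cseminorm ?p" unfolding cseminorm_def by blast
qed

text \<open>Let \<open>w = x - (\<mu> *\<^sub>C z - T z)\<close>. For nonzero \<open>\<mu>\<close>,
  the sum of \<open>\<mu>^(-k) T^k w\<close> over \<open>k < n\<close> telescopes to
  \<open>n x + \<mu>^(1-n) T^n z - \<mu> z\<close>. Its \<open>q\<close>-value is at most
  \<open>n q w\<close>, and the terms in \<open>z\<close> stay bounded, so division by
  \<open>n\<close> gives the claim in the limit.\<close>

lemma eigenvector_distance_range:
  fixes T :: "'a::complex_vector \<Rightarrow> 'a"
  assumes add: "\<And>x y. T (x + y) = T x + T y" and scale: "\<And>c x. T (c *\<^sub>C x) = c *\<^sub>C T x"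
    and q: "cseminorm q" and le: "\<And>x. q (T x) \<le> cmod \<mu> * q x"
    and eig: "T x = \<mu> *\<^sub>C x"
  shows "q x \<le> q (x - (\<mu> *\<^sub>C z - T z))"
proof (cases "\<mu> = 0")
  \<comment> \<open>Here \<open>q\<close> vanishes on the range of \<open>T\<close>, so adding
    \<open>T z\<close> does not change the value at \<open>x\<close>.\<close>
  case True
  then have "q (T z) = 0"
    using le[of z] cseminorm_nonneg[OF q, of "T z"] by simp
  with True show ?thesis
    using cseminorm_diff[OF q, of "x + T z" "T z"] by simp
next
  case False
  define w where "w = x - (\<mu> *\<^sub>C z - T z)"
  \<comment> \<open>Up to the term \<open>\<mu> ^ Suc n *\<^sub>C z\<close>, this is the telescoped
    sum multiplied by \<open>\<mu> ^ n\<close>, a form free of inverses that satisfies a one-step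
    recursion.\<close>
  define u where "u n = \<mu> *\<^sub>C (T ^^ n) z + (of_nat n * \<mu> ^ n) *\<^sub>C x" for n
  have T_add: "(T ^^ n) (a + b) = (T ^^ n) a + (T ^^ n) b" for n a b
    by (induction n) (simp_all add: add)
  have T_scale: "(T ^^ n) (c *\<^sub>C a) = c *\<^sub>C (T ^^ n) a" for n c a
    by (induction n) (simp_all add: scale)
  have T_x: "(T ^^ n) x = \<mu> ^ n *\<^sub>C x" for n
    by (induction n) (simp_all add: scale eig scaleC_scaleC scaleC_one ac_simps)
  have u_Suc: "u (Suc n) = \<mu> *\<^sub>C ((T ^^ n) w + u n)" for n
  proof -
    have "T z + x = w + \<mu> *\<^sub>C z" by (simp add: w_def)
    then have "(T ^^ n) (T z) + \<mu> ^ n *\<^sub>C x = (T ^^ n) w + \<mu> *\<^sub>C (T ^^ n) z"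
      by (metis T_add T_scale T_x)
    then have *: "(T ^^ Suc n) z = (T ^^ n) w + \<mu> *\<^sub>C (T ^^ n) z - \<mu> ^ n *\<^sub>C x"
      unfolding funpow_Suc_right comp_apply by (metis add_diff_cancel_right')
    show ?thesis
      unfolding u_def *
      by (simp add: scaleC_add_right scaleC_add_left complex_vector.scale_right_diff_distrib
          scaleC_scaleC algebra_simps)
  qed
  have u_le: "q (u n) \<le> cmod \<mu> ^ n * (n * q w + cmod \<mu> * q z)" for n
  proof (induction n)
    case 0
    show ?case by (simp add: u_def cseminorm_scaleC[OF q])
  next
    case (Suc n)
    have "q ((T ^^ n) w + u n) \<le> cmod \<mu> ^ n * q w + cmod \<mu> ^ n * (n * q w + cmod \<mu> * q z)"
      using cseminorm_add[OF q, of "(T ^^ n) w" "u n"] Suc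
        seminorm_funpow_le[of q T "cmod \<mu>" n w, OF le] by simp
    then have "q (u (Suc n))
        \<le> cmod \<mu> * (cmod \<mu> ^ n * q w + cmod \<mu> ^ n * (n * q w + cmod \<mu> * q z))"
      unfolding u_Suc cseminorm_scaleC[OF q] by (rule mult_left_mono) simp
    then show ?case by (simp add: algebra_simps)
  qed
  have "of_nat n * (q x - q w) \<le> 2 * cmod \<mu> * q z" for n
  proof -
    have "cmod \<mu> ^ n * (n * q x) = q (u n - \<mu> *\<^sub>C (T ^^ n) z)"
      by (simp add: u_def cseminorm_scaleC[OF q] norm_mult norm_power)
    also have "\<dots> \<le> q (u n) + cmod \<mu> * q ((T ^^ n) z)"
      using cseminorm_diff[OF q, of "u n"] by (simp add: cseminorm_scaleC[OF q, symmetric])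
    also have "\<dots> \<le> cmod \<mu> ^ n * (n * q w + cmod \<mu> * q z) + cmod \<mu> * (cmod \<mu> ^ n * q z)"
      by (intro add_mono u_le mult_left_mono seminorm_funpow_le le) auto
    also have "\<dots> = cmod \<mu> ^ n * (n * q w + 2 * cmod \<mu> * q z)"
      by (simp add: algebra_simps)
    finally have "n * q x \<le> n * q w + 2 * cmod \<mu> * q z"
      using False by (simp add: mult_le_cancel_left_pos)
    then show ?thesis by (simp add: algebra_simps)
  qed
  \<comment> \<open>Archimedean property: the multiples of \<open>q x - q w\<close> have an upper
    bound independent of \<open>n\<close>.\<close>
  then have "\<not> 0 < q x - q w"
    by (metis ex_less_of_nat_mult not_less)
  then show ?thesis by (simp add: w_def)
qed

text \<open>A functional satisfies the eigenvalue equation once it vanishes on the range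
  \<open>M\<close> of \<open>\<mu> - T\<close>. Domination by the distance to \<open>M\<close>
  ensures this, and the distance of \<open>x\<close> from \<open>M\<close> is the full
  \<open>q x\<close>.\<close>

lemma ex_dual_eigenvector:
  fixes T :: "'a::complex_lcs \<Rightarrow> 'a"
  assumes add: "\<And>x y. T (x + y) = T x + T y" and scale: "\<And>c x. T (c *\<^sub>C x) = c *\<^sub>C T x"
    and q: "cseminorm q" and cont: "continuous_on UNIV q"
    and le: "\<And>x. q (T x) \<le> cmod \<mu> * q x"
    and eig: "T x = \<mu> *\<^sub>C x"
  obtains \<psi> where "\<And>y. dual_apply \<psi> (T y) = \<mu> * dual_apply \<psi> y"
    "dual_apply \<psi> x = complex_of_real (q x)"
proof -
  define M where "M = range (\<lambda>z. \<mu> *\<^sub>C z - T z)"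
  have M: "complex_vector.subspace M"
    unfolding complex_vector.subspace_def
  proof safe
    have "T 0 = 0" using add[of 0 0] by simp
    then show "0 \<in> M" unfolding M_def by (intro image_eqI[of _ _ 0]) auto
  next
    fix a b assume "a \<in> M" "b \<in> M"
    then obtain y z where "a = \<mu> *\<^sub>C y - T y" "b = \<mu> *\<^sub>C z - T z" by (auto simp: M_def)
    then show "a + b \<in> M"
      unfolding M_def by (intro image_eqI[of _ _ "y + z"]) (auto simp: add scaleC_add_right)
  next
    fix c a assume "a \<in> M"
    then obtain y where "a = \<mu> *\<^sub>C y - T y" by (auto simp: M_def)
    then show "c *\<^sub>C a \<in> M"
      unfolding M_def by (intro image_eqI[of _ _ "c *\<^sub>C y"])
        (auto simp: scale scaleC_scaleC complex_vector.scale_right_diff_distrib mult.commute)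
  qed
  let ?p = "\<lambda>y. INF m\<in>M. q (y - m)"
  note p = cseminorm_quotient[OF q M]
  have p_le: "?p y \<le> q y" for y
    using p(2)[OF complex_vector.subspace_0[OF M], of y] by simp
  have p_x: "?p x = q x"
    using complex_vector.subspace_0[OF M]
    by (intro antisym p_le cINF_greatest)
      (auto simp: M_def intro: eigenvector_distance_range[OF add scale q le eig])
  obtain \<psi> where \<psi>: "\<And>y. cmod (dual_apply \<psi> y) \<le> ?p y" "dual_apply \<psi> x = complex_of_real (?p x)"
    using ex_dual_dominated[OF p(1) p_le cont cseminorm_zero[OF q]] by blast
  have "dual_apply \<psi> (T y) = \<mu> * dual_apply \<psi> y" for y
  proof -
    have "\<mu> *\<^sub>C y - T y \<in> M" by (simp add: M_def)
    \<comment> \<open>An element of \<open>M\<close> has distance 0 from \<open>M\<close>, as it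
      approximates itself.\<close>
    from order_trans[OF \<psi>(1) p(2)[OF this], of "\<mu> *\<^sub>C y - T y"] have "dual_apply \<psi> (\<mu> *\<^sub>C y - T y) = 0"
      by (simp add: cseminorm_zero[OF q])
    then show ?thesis by (simp add: dual_apply_diff dual_apply_scaleC)
  qed
  then show thesis by (rule that[of \<psi>]) (use \<psi>(2) p_x in simp)
qed

section \<open>Exclusion of eigenvalues\<close>

text \<open>Common core of both parts: a \<open>q\<close>-contraction satisfies the bound for
  \<open>\<bar>\<mu>\<bar> = 1\<close>, and an operator on a Banach space satisfies it with
  \<open>q = norm\<close> for \<open>\<bar>\<mu>\<bar>\<close> at least the operator norm.\<close>

lemma weakly_supercyclic_point_spectrum:
  fixes T :: "'a::complex_lcs \<Rightarrow> 'a"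
  assumes inf: "infinite_dimensional TYPE('a)" and T: "continuous_clinear T" "weakly_supercyclic T"
    and q: "continuous_norm q" and le: "\<And>x. q (T x) \<le> cmod \<mu> * q x"
  shows "\<mu> \<notin> point_spectrum T" and "\<mu> \<notin> point_spectrum (adjoint_op T)"
proof -
  have q': "cseminorm q" "\<And>x. q x = 0 \<Longrightarrow> x = 0" "continuous_on UNIV q"
    using q by (auto simp: continuous_norm_def cseminorm_def)
  note no = weakly_supercyclic_no_dual_eigenvector[OF inf T(2) q' le]
  show "\<mu> \<notin> point_spectrum (adjoint_op T)"
  proof
    assume "\<mu> \<in> point_spectrum (adjoint_op T)"
    then obtain \<phi> where "\<phi> \<noteq> 0" "adjoint_op T \<phi> = \<mu> *\<^sub>C \<phi>"
      by (auto simp: point_spectrum_def)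
    then have "dual_apply \<phi> (T x) = \<mu> * dual_apply \<phi> x" for x
      by (metis dual_apply_adjoint_op[OF T(1)] scaleC_dual.rep_eq)
    with no \<open>\<phi> \<noteq> 0\<close> show False by blast
  qed
  show "\<mu> \<notin> point_spectrum T"
  proof
    assume "\<mu> \<in> point_spectrum T"
    then obtain x where x: "x \<noteq> 0" "T x = \<mu> *\<^sub>C x"
      by (auto simp: point_spectrum_def)
    have "\<And>x y. T (x + y) = T x + T y" "\<And>c x. T (c *\<^sub>C x) = c *\<^sub>C T x"
      using T(1) by (auto simp: continuous_clinear_iff)
    then obtain \<psi> where \<psi>: "\<And>y. dual_apply \<psi> (T y) = \<mu> * dual_apply \<psi> y"
      "dual_apply \<psi> x = complex_of_real (q x)"
      using ex_dual_eigenvector[OF _ _ q'(1,3) le x(2)] by blast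
    then have "q x = 0" using no[of \<psi>] by (simp add: zero_dual.rep_eq)
    with q'(2) x(1) show False by blast
  qed
qed

text \<open>\<open>onorm\<close> is a supremum of quotients, so its defining bound requires
  boundedness of \<open>S\<close> first; this follows from continuity at 0.\<close>

lemma norm_le_onorm_continuous_clinear:
  fixes S :: "'x::complex_normed_vector \<Rightarrow> 'x"
  assumes S: "continuous_clinear S"
  shows "norm (S x) \<le> onorm S * norm x"
proof (rule onorm)
  have lin: "linear S"
    using S by (intro linearI) (auto simp: continuous_clinear_iff scaleR_scaleC)
  have "isCont S 0"
    using S by (simp add: continuous_clinear_def continuous_on_eq_continuous_at)
  then obtain d where d: "0 < d" "\<And>y. norm y < d \<Longrightarrow> norm (S y) < 1"
    using linear_0[OF lin] unfolding continuous_at_eps_delta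
    by (metis diff_zero dist_norm zero_less_one)
  have "norm (S x) \<le> norm x * (2 / d)" for x
  proof (cases "x = 0")
    case False
    \<comment> \<open>Scales \<open>x\<close> to norm \<open>d / 2\<close>, inside the ball on which
      \<open>S\<close> is bounded by 1.\<close>
    define r where "r = d / (2 * norm x)"
    with False d have r: "0 < r" by simp
    have "norm (S (r *\<^sub>R x)) < 1"
      by (rule d(2)) (use False d in \<open>simp add: r_def\<close>)
    then have "r * norm (S x) < 1"
      using r by (simp add: linear_scale[OF lin])
    then show ?thesis
      using False d by (simp add: r_def field_simps)
  qed (simp add: linear_0[OF lin])
  with lin show "bounded_linear S"
    by (intro bounded_linear_intro[where K = "2 / d"]) (auto simp: linear_add linear_scale)
qed

theorem theoremC:
  fixes T :: "'e::complex_lcs \<Rightarrow> 'e" and q :: "'e \<Rightarrow> real"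
    and S :: "'x::complex_banach \<Rightarrow> 'x"
  shows "(infinite_dimensional TYPE('e) \<and> continuous_clinear T \<and> weakly_supercyclic T \<and>
            continuous_norm q \<and> (\<forall>x. q (T x) \<le> q x) \<longrightarrow>
          point_spectrum T \<inter> sphere 0 1 = {} \<and>
          point_spectrum (adjoint_op T) \<inter> sphere 0 1 = {} \<and>
          (\<forall>x. T x = x \<longrightarrow> x = 0) \<and>
          (\<forall>\<phi>. adjoint_op T \<phi> = \<phi> \<longrightarrow> \<phi> = 0))
       \<and> (infinite_dimensional TYPE('x) \<and> continuous_clinear S \<and> weakly_supercyclic S \<longrightarrow>
          point_spectrum S \<subseteq> ball 0 (onorm S) \<and>
          point_spectrum (adjoint_op S) \<subseteq> ball 0 (onorm S))"
proof (rule conjI; rule impI; elim conjE)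
  assume *: "infinite_dimensional TYPE('e)" "continuous_clinear T" "weakly_supercyclic T"
    "continuous_norm q" "\<forall>x. q (T x) \<le> q x"
  have spec: "\<mu> \<notin> point_spectrum T" "\<mu> \<notin> point_spectrum (adjoint_op T)" if "cmod \<mu> = 1" for \<mu>
    using weakly_supercyclic_point_spectrum[OF *(1-4), of \<mu>] *(5) that by simp_all
  then have "point_spectrum T \<inter> sphere 0 1 = {}" "point_spectrum (adjoint_op T) \<inter> sphere 0 1 = {}"
    by auto
  moreover have "\<forall>x. T x = x \<longrightarrow> x = 0" "\<forall>\<phi>. adjoint_op T \<phi> = \<phi> \<longrightarrow> \<phi> = 0"
    using spec[of 1] by (auto simp: point_spectrum_def scaleC_one)
  ultimately show "point_spectrum T \<inter> sphere 0 1 = {} \<and>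
      point_spectrum (adjoint_op T) \<inter> sphere 0 1 = {} \<and>
      (\<forall>x. T x = x \<longrightarrow> x = 0) \<and> (\<forall>\<phi>. adjoint_op T \<phi> = \<phi> \<longrightarrow> \<phi> = 0)"
    by blast
next
  assume *: "infinite_dimensional TYPE('x)" "continuous_clinear S" "weakly_supercyclic S"
  have norm: "continuous_norm (norm :: 'x \<Rightarrow> real)"
    by (auto simp: continuous_norm_def norm_scaleC norm_triangle_ineq intro: continuous_intros)
  have "\<mu> \<notin> point_spectrum S" "\<mu> \<notin> point_spectrum (adjoint_op S)" if "onorm S \<le> cmod \<mu>" for \<mu>
  proof -
    have "norm (S x) \<le> cmod \<mu> * norm x" for x
      using norm_le_onorm_continuous_clinear[OF *(2), of x] that
      by (meson mult_right_mono norm_ge_zero order_trans)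
    then show "\<mu> \<notin> point_spectrum S" "\<mu> \<notin> point_spectrum (adjoint_op S)"
      using weakly_supercyclic_point_spectrum[OF * norm] by blast+
  qed
  then show "point_spectrum S \<subseteq> ball 0 (onorm S) \<and>
      point_spectrum (adjoint_op S) \<subseteq> ball 0 (onorm S)"
    by (metis mem_ball_0 not_less subsetI)
qed

end
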